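(* Let $N \geq 5$ and $d \geq 1$ be integers, and let $A = \{a_1,\dots,a_d\}$ be a set of $d$ nonzero elements of $\mathbb{Z}/N\mathbb{Z}$ (so $|A| = d$). Let $G = \mathrm{Cay}(\mathbb{Z}/N\mathbb{Z},E_A)$ be the directed Cayley graph constructed from $A$, and assume that $G$ has no digons. If $d \leq \dfrac{N-1}{4}$, then $\beta(G) \leq \dfrac{\gamma(G)}{2}$.
   Context: A finite directed graph $G=(V,E)$ consists of a finite vertex set $V$ and an edge set $E \subseteq V\times V$. A directed cycle of length $l$ is a sequence of $l \ge 1$ edges $(v_{i-1},v_i)$, $i=1,\dots,l$, with $v_0=v_l$; a digon is a directed cycle of length $2$. A directed graph is acyclic if it has no directed cycles. $\beta(G)$ is the minimum size of a subset $X \subseteq E$ such that $(V, E\smallsetminus X)$ is acyclic. $\gamma(G)$ is the number of unordered pairs of distinct nonadjacent vertices in the undirected graph obtained from $G$ by replacing each directed edge with an undirected edge. For $A \subseteq \mathbb{Z}/N\mathbb{Z}$, the directed Cayley graph $\mathrm{Cay}(\mathbb{Z}/N\mathbb{Z},E_A)$ has vertex set $\mathbb{Z}/N\mathbb{Z}$ and edge set $E_A=\{(x,x+a): x\in\mathbb{Z}/N\mathbb{Z},\ a\in A\}$. *)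

theory Defs
  imports "Graph_Theory.Graph_Theory" "HOL-Number_Theory.Residues"
begin

text \<open>
  A directed graph with edge set a subset of \<open>V \<times> V\<close> is a \<^typ>\<open>'a pair_pre_digraph\<close>, with
  finiteness and well-formedness expressed by the locale \<^locale>\<open>pair_fin_digraph\<close>.
  A directed cycle is a closed walk with at least one arc; vertices and arcs may repeat, and a
  loop is a directed cycle of length 1. This agrees with the library's \<open>closed_w\<close> (which lives in
  the locale of well-formed digraphs), not with its \<open>cycle\<close>, which asks for distinct vertices.
\<close>

definition directed_cycle :: "'a pair_pre_digraph \<Rightarrow> ('a \<times> 'a) list \<Rightarrow> bool" where
  "directed_cycle G p \<longleftrightarrow> p \<noteq> [] \<and> (\<exists>u. pre_digraph.awalk (with_proj G) u p u)"

definition digon :: "'a pair_pre_digraph \<Rightarrow> ('a \<times> 'a) list \<Rightarrow> bool" where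
  "digon G p \<longleftrightarrow> directed_cycle G p \<and> length p = 2"

definition acyclic_digraph :: "'a pair_pre_digraph \<Rightarrow> bool" where
  "acyclic_digraph G \<longleftrightarrow> (\<nexists>p. directed_cycle G p)"

lemma directed_cycle_iff_closed_w:
  assumes "pair_wf_digraph G"
  shows "directed_cycle G p \<longleftrightarrow> wf_digraph.closed_w (with_proj G) p"
proof -
  interpret pair_wf_digraph G by fact
  have "wf_digraph (with_proj G)" by unfold_locales
  then show ?thesis
    unfolding directed_cycle_def by (auto simp: wf_digraph.closed_w_def)
qed

text \<open>
  The next two numbers are meaningful for finite digraphs only, since \<^const>\<open>card\<close> is 0 on
  infinite sets.
\<close>

definition beta :: "'a pair_pre_digraph \<Rightarrow> nat" where
  "beta G = Min {card X | X. X \<subseteq> parcs G \<and>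
     acyclic_digraph \<lparr>pverts = pverts G, parcs = parcs G - X\<rparr>}"

text \<open>
  \<open>mk_symmetric G\<close> is the underlying undirected graph, each undirected edge being represented by
  the two opposite arcs.
\<close>

definition gamma :: "'a pair_pre_digraph \<Rightarrow> nat" where
  "gamma G = card {{u, v} | u v. u \<in> pverts G \<and> v \<in> pverts G \<and> u \<noteq> v \<and>
     (u, v) \<notin> parcs (mk_symmetric (with_proj G))}"

definition cayley_digraph :: "nat \<Rightarrow> int set \<Rightarrow> int pair_pre_digraph" where
  "cayley_digraph N A =
     \<lparr>pverts = carrier (residue_ring (int N)),
      parcs = {(x, x \<oplus>\<^bsub>residue_ring (int N)\<^esub> a) | x a. x \<in> carrier (residue_ring (int N)) \<and> a \<in> A}\<rparr>"

lemma pair_fin_digraph_cayley_digraph: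
  assumes "N > 0" and "A \<subseteq> carrier (residue_ring (int N))"
  shows "pair_fin_digraph (cayley_digraph N A)"
proof -
  have sub: "parcs (cayley_digraph N A) \<subseteq> {0..int N - 1} \<times> {0..int N - 1}"
    using assms by (auto simp: cayley_digraph_def residue_ring_def)
  show ?thesis
  proof
    show "finite (parcs (cayley_digraph N A))"
      using sub by (rule finite_subset) simp
  qed (use sub in \<open>auto simp: cayley_digraph_def residue_ring_def\<close>)
qed

end

theory Submission
  imports Defs
begin

text \<open>
  Listing the vertices in a linear order splits the arcs of a loopless digraph into ascending and
  descending ones, and deleting either class leaves an acyclic digraph; so \<open>\<beta>(G) \<le> |E| / 2\<close>.
  On the other hand \<open>\<gamma>(G) \<ge> N(N-1)/2 - |E|\<close>. For the Cayley digraph \<open>|E| \<le> Nd\<close>, and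
  \<open>4d \<le> N-1\<close> gives \<open>2|E| \<le> N(N-1)/2\<close>, hence \<open>|E| \<le> \<gamma>(G)\<close>.
\<close>

text \<open>Transitivity chains the arcs of the walk. \<open>R\<close> need not be reflexive, so the
  empty walk is excluded and a single arc is the true base case.\<close>

lemma cas_transp:
  assumes "pre_digraph.cas (with_proj G) u p v" "p \<noteq> []"
    and "\<And>x y. (x, y) \<in> set p \<Longrightarrow> R x y" and "transp R"
  shows "R u v"
  using assms(1-3)
proof (induction p arbitrary: u)
  case (Cons e p)
  have e: "fst e = u" and cas: "pre_digraph.cas (with_proj G) (snd e) p v"
    using Cons.prems(1) by (simp_all add: pre_digraph.cas.simps)
  have R: "R u (snd e)"
    using Cons.prems(3)[of "fst e" "snd e"] by (simp flip: e)
  show ?case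
  proof (cases "p = []")
    case True
    then show ?thesis
      using R cas by (simp add: pre_digraph.cas.simps)
  next
    case False
    then have "R (snd e) v"
      using Cons.IH[OF cas] Cons.prems(3) by simp
    then show ?thesis
      using R \<open>transp R\<close> by (blast dest: transpD)
  qed
qed simp

text \<open>A directed cycle through \<open>u\<close> would chain to \<open>R u u\<close>, against
  irreflexivity.\<close>

lemma acyclic_digraph_if_strict_order:
  assumes "\<And>x y. (x, y) \<in> parcs G \<Longrightarrow> R x y" and "transp R" and "irreflp R"
  shows "acyclic_digraph G"
  unfolding acyclic_digraph_def
proof
  assume "\<exists>p. directed_cycle G p"
  then obtain p u where "p \<noteq> []" "pre_digraph.awalk (with_proj G) u p u"
    by (auto simp: directed_cycle_def)
  then have "R u u"
    using cas_transp[of G u p u R] assms(1,2) by (auto simp: pre_digraph.awalk_def)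
  then show False
    using \<open>irreflp R\<close> by (simp add: irreflp_def)
qed

lemma beta_le:
  assumes "finite (parcs G)" "X \<subseteq> parcs G"
    and "acyclic_digraph \<lparr>pverts = pverts G, parcs = parcs G - X\<rparr>"
  shows "beta G \<le> card X"
  unfolding beta_def
proof (rule Min_le)
  show "finite {card X |X. X \<subseteq> parcs G \<and>
    acyclic_digraph \<lparr>pverts = pverts G, parcs = parcs G - X\<rparr>}"
    by (rule finite_subset[of _ "card ` Pow (parcs G)"]) (use assms(1) in auto)
qed (use assms in auto)

lemma two_beta_le_card_parcs:
  fixes G :: "'a::linorder pair_pre_digraph"
  assumes fin: "finite (parcs G)" and loopless: "\<And>x. (x, x) \<notin> parcs G"
  shows "2 * beta G \<le> card (parcs G)"
proof -
  let ?U = "{e \<in> parcs G. fst e < snd e}" and ?D = "{e \<in> parcs G. snd e < fst e}"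
  \<comment> \<open>With the ascending arcs deleted, the absence of loops makes every remaining arc
    strictly descending, so \<open>(>)\<close> is the witnessing order. The optional rule fires only
    on the acyclicity goal, not on the inclusion.\<close>
  have "beta G \<le> card ?U"
    by (rule beta_le[OF fin]; (rule acyclic_digraph_if_strict_order[where R = "(>)"])?)
      (use loopless in \<open>auto simp: irreflp_def not_less le_less\<close>)
  moreover have "beta G \<le> card ?D"
    by (rule beta_le[OF fin]; (rule acyclic_digraph_if_strict_order[where R = "(<)"])?)
      (use loopless in \<open>auto simp: irreflp_def not_less le_less\<close>)
  moreover have "card ?U + card ?D = card (?U \<union> ?D)"
    by (rule card_Un_disjoint[symmetric]) (use fin in auto)
  moreover have "card (?U \<union> ?D) \<le> card (parcs G)"
    by (rule card_mono) (use fin in auto)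
  ultimately show ?thesis by linarith
qed

text \<open>Each pair of distinct vertices is nonadjacent or the endpoint set of some arc. Opposite
  arcs share an endpoint set and loops give singletons, so only an inequality results.\<close>

lemma choose_2_le_gamma_plus_card_parcs:
  assumes finV: "finite (pverts G)" and finE: "finite (parcs G)"
  shows "card (pverts G) choose 2 \<le> gamma G + card (parcs G)"
proof -
  let ?P = "{S. S \<subseteq> pverts G \<and> card S = 2}"
  let ?N = "{{u, v} | u v. u \<in> pverts G \<and> v \<in> pverts G \<and> u \<noteq> v \<and>
     (u, v) \<notin> parcs (mk_symmetric (with_proj G))}"
  let ?E = "(\<lambda>(u, v). {u, v}) ` parcs G"
  have sub: "?P \<subseteq> ?N \<union> ?E"
  proof
    fix S assume "S \<in> ?P"
    then obtain u v where S: "S = {u, v}" "u \<noteq> v" "u \<in> pverts G" "v \<in> pverts G"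
      by (auto simp: card_2_iff)
    show "S \<in> ?N \<union> ?E"
    proof (cases "(u, v) \<in> parcs (mk_symmetric (with_proj G))")
      case True
      then have "(u, v) \<in> parcs G \<or> (v, u) \<in> parcs G"
        by (auto simp: parcs_mk_symmetric)
      then have "S \<in> ?E"
        using S(1) by (force simp: insert_commute)
      then show ?thesis ..
    next
      case False
      then show ?thesis using S by blast
    qed
  qed
  have finN: "finite ?N"
    by (rule finite_subset[of _ "Pow (pverts G)"]) (use finV in auto)
  have "card (pverts G) choose 2 = card ?P"
    by (rule n_subsets[OF finV, symmetric])
  also have "\<dots> \<le> card (?N \<union> ?E)"
    by (rule card_mono[OF _ sub]) (use finN finE in simp)
  also have "\<dots> \<le> card ?N + card ?E"
    by (rule card_Un_le)
  also have "\<dots> \<le> gamma G + card (parcs G)"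
    unfolding gamma_def using card_image_le[OF finE] by simp
  finally show ?thesis .
qed

lemma card_parcs_cayley_digraph_le:
  assumes "finite A"
  shows "card (parcs (cayley_digraph N A)) \<le> N * card A"
proof -
  let ?R = "residue_ring (int N)"
  have "parcs (cayley_digraph N A) = (\<lambda>(x, a). (x, x \<oplus>\<^bsub>?R\<^esub> a)) ` (carrier ?R \<times> A)"
    by (auto simp: cayley_digraph_def)
  then have "card (parcs (cayley_digraph N A)) \<le> card (carrier ?R \<times> A)"
    using card_image_le[of "carrier ?R \<times> A"] assms by (simp add: residue_ring_def)
  then show ?thesis
    by (simp add: card_cartesian_product residue_ring_def)
qed

text \<open>A loop would force \<open>a\<close> to vanish modulo \<open>N\<close>, but elements of
  \<open>A\<close> are representatives strictly between 0 and \<open>N\<close>.\<close>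

lemma cayley_digraph_loopless:
  assumes "A \<subseteq> carrier (residue_ring (int N)) - {\<zero>\<^bsub>residue_ring (int N)\<^esub>}"
  shows "(x, x) \<notin> parcs (cayley_digraph N A)"
proof
  assume "(x, x) \<in> parcs (cayley_digraph N A)"
  then obtain a where "a \<in> A" and x: "0 \<le> x" "x < int N" "x = (x + a) mod int N"
    by (auto simp: cayley_digraph_def residue_ring_def)
  then have "int N dvd a"
    by (metis add_diff_cancel_left' mod_eq_dvd_iff mod_mod_trivial)
  moreover have "0 < a" "a < int N"
    using assms \<open>a \<in> A\<close> by (force simp: residue_ring_def)+
  ultimately show False
    by (auto dest: zdvd_imp_le)
qed

theorem theorem3p5:
  fixes N d :: nat and A :: "int set"
  assumes "N \<ge> 5" and "d \<ge> 1"
    and "A \<subseteq> carrier (residue_ring (int N)) - {\<zero>\<^bsub>residue_ring (int N)\<^esub>}"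
    and "card A = d"
    and "\<nexists>p. digon (cayley_digraph N A) p"
    and "real d \<le> (real N - 1) / 4"
  shows "real (beta (cayley_digraph N A)) \<le> real (gamma (cayley_digraph N A)) / 2"
proof -
  let ?G = "cayley_digraph N A"
  \<comment> \<open>An infinite set has \<open>card\<close> 0, which \<open>d \<ge> 1\<close> rules
    out.\<close>
  have "finite A"
    using \<open>card A = d\<close> \<open>d \<ge> 1\<close> by (simp add: card_ge_0_finite)
  then have E: "card (parcs ?G) \<le> N * d"
    using card_parcs_cayley_digraph_le[of A N] \<open>card A = d\<close> by simp
  interpret pair_fin_digraph ?G
    by (rule pair_fin_digraph_cayley_digraph) (use assms in auto)
  have beta: "2 * beta ?G \<le> card (parcs ?G)"
    by (rule two_beta_le_card_parcs[OF _ cayley_digraph_loopless[OF assms(3)]]) simp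
  have "card (pverts ?G) = N"
    by (simp add: cayley_digraph_def residue_ring_def)
  then have gamma: "N choose 2 \<le> gamma ?G + card (parcs ?G)"
    using choose_2_le_gamma_plus_card_parcs[of ?G] by simp
  \<comment> \<open>\<open>N \<ge> 5\<close> keeps the natural subtraction from truncating.\<close>
  have "real (4 * d) \<le> real (N - 1)"
    using assms(1,6) by (simp add: of_nat_diff)
  then have "4 * d \<le> N - 1"
    by (simp only: of_nat_le_iff)
  then have "N * (4 * d) \<le> N * (N - 1)"
    by (rule mult_le_mono2)
  \<comment> \<open>This form exposes the factor 2 matching the \<open>div 2\<close> that
    \<open>choose_two\<close> introduces.\<close>
  moreover have "2 * (N * d) * 2 = N * (4 * d)"
    by simp
  ultimately have "2 * (N * d) \<le> N choose 2"
    unfolding choose_two by linarith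
  \<comment> \<open>With E the arc set: \<open>\<gamma> \<ge> 2 * (N * d) - |E| \<ge> N * d \<ge>
    |E| \<ge> 2 * \<beta>\<close>.\<close>
  then have "2 * beta ?G \<le> gamma ?G"
    using E beta gamma by linarith
  then show ?thesis by simp
qed

end
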